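(* Let $\xi=(\xi_1,\xi_2)$ be an $S\alpha S$ random vector in $\mathbb{R}^2$ with $\alpha\in(1,2]$ and associated zonoid $K$. Then the covariation of $\xi_1$ on $\xi_2$ satisfies $$[\xi_1,\xi_2]_\alpha=x_1x_2^{\alpha-1},$$ where $T(K,(0,1))=\{(x_1,x_2)\}$ is the support point of $K$ in direction $(0,1)$.
   Context: A random vector $\xi\in\mathbb{R}^d$ is symmetric $\alpha$-stable ($S\alpha S$) if $\xi$ has the same distribution as $-\xi$ and $a^{1/\alpha}\xi'+b^{1/\alpha}\xi''$ has the same distribution as $(a+b)^{1/\alpha}\xi$ for all $a,b>0$, where $\xi',\xi''$ are independent copies of $\xi$. Its characteristic function is $\mathbf{E}e^{i\langle\xi,u\rangle}=\exp\{-\int_{\mathbb{S}^{d-1}}|\langle u,z\rangle|^\alpha\sigma(dz)\}$ for a symmetric finite measure $\sigma$ (the spectral measure) on the Euclidean unit sphere $\mathbb{S}^{d-1}$. For $\alpha\in[1,2]$ the associated zonoid of $\xi$ is the origin-symmetric convex compact set $K$ whose support function $h(K,u)=\sup\{\langle x,u\rangle:x\in K\}$ satisfies $h(K,u)^\alpha=\int_{\mathbb{S}^{d-1}}|\langle u,z\rangle|^\alpha\sigma(dz)$. The support set of $K$ in direction $u$ is $T(K,u)=\{y\in K:\langle y,u\rangle=h(K,u)\}$. For $\xi=(\xi_1,\xi_2)$ $S\alpha S$ in $\mathbb{R}^2$ with $\alpha>1$ and spectral measure $\sigma$, the covariation of $\xi_1$ on $\xi_2$ is $[\xi_1,\xi_2]_\alpha=\int_{\mathbb{S}^1}s_1s_2^{\langle\alpha-1\rangle}\sigma(ds)$,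 where $t^{\langle\lambda\rangle}=|t|^\lambda\mathrm{sign}(t)$. *)

theory Defs
  imports "HOL-Probability.Probability"
begin

text \<open>
  Independent copies of \<open>\<xi>\<close> are realised as the two coordinate
  copies on the product space \<open>M \<Otimes>\<^sub>M M\<close>; the law of the
  combination depends only on the law of \<open>\<xi>\<close>.
\<close>

definition sym_stable ::
  "'w measure \<Rightarrow> real \<Rightarrow> ('w \<Rightarrow> 'a::euclidean_space) \<Rightarrow> bool" where
  "sym_stable M \<alpha> \<xi> \<longleftrightarrow>
     distr M borel (\<lambda>\<omega>. - \<xi> \<omega>) = distr M borel \<xi> \<and>
     (\<forall>a>0. \<forall>b>0.
        distr (M \<Otimes>\<^sub>M M) borel
          (\<lambda>(\<omega>', \<omega>''). a powr (1/\<alpha>) *\<^sub>R \<xi> \<omega>' + b powr (1/\<alpha>) *\<^sub>R \<xi> \<omega>'')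
        = distr M borel (\<lambda>\<omega>. (a + b) powr (1/\<alpha>) *\<^sub>R \<xi> \<omega>))"

text \<open>
  A predicate rather than a function of \<open>\<xi>\<close>: for \<open>\<alpha> = 2\<close> the measure
  \<open>\<sigma>\<close> is not determined by \<open>\<xi>\<close>.
\<close>

definition spectral_measure ::
  "'w measure \<Rightarrow> real \<Rightarrow> ('w \<Rightarrow> 'a::euclidean_space) \<Rightarrow> 'a measure \<Rightarrow> bool" where
  "spectral_measure M \<alpha> \<xi> \<sigma> \<longleftrightarrow>
     finite_measure \<sigma> \<and>
     space \<sigma> = sphere 0 1 \<and>
     sets \<sigma> = sets (restrict_space borel (sphere 0 1)) \<and>
     distr \<sigma> \<sigma> uminus = \<sigma> \<and>
     (\<forall>u. (CLINT \<omega>|M. iexp (\<xi> \<omega> \<bullet> u))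
          = exp (- complex_of_real (LINT z|\<sigma>. \<bar>u \<bullet> z\<bar> powr \<alpha>)))"

text \<open>Only meaningful for nonempty bounded \<open>K\<close>, where the supremum exists in the reals.\<close>

definition support_fun :: "'a::euclidean_space set \<Rightarrow> 'a \<Rightarrow> real" where
  "support_fun K u = (SUP x\<in>K. x \<bullet> u)"

definition support_set :: "'a::euclidean_space set \<Rightarrow> 'a \<Rightarrow> 'a set" where
  "support_set K u = {y \<in> K. y \<bullet> u = support_fun K u}"

text \<open>
  The integral on the right-hand side is the same for every spectral measure of \<open>\<xi>\<close>,
  being determined by the characteristic function, so the choice of \<open>\<sigma>\<close> is immaterial.
\<close>

definition associated_zonoid ::
  "'w measure \<Rightarrow> real \<Rightarrow> ('w \<Rightarrow> 'a::euclidean_space) \<Rightarrow> 'a set \<Rightarrow> bool" where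
  "associated_zonoid M \<alpha> \<xi> K \<longleftrightarrow>
     K \<noteq> {} \<and> compact K \<and> convex K \<and> uminus ` K = K \<and>
     (\<exists>\<sigma>. spectral_measure M \<alpha> \<xi> \<sigma> \<and>
        (\<forall>u. support_fun K u powr \<alpha> = (LINT z|\<sigma>. \<bar>u \<bullet> z\<bar> powr \<alpha>)))"

definition signed_powr :: "real \<Rightarrow> real \<Rightarrow> real" where
  "signed_powr t l = \<bar>t\<bar> powr l * sgn t"

text \<open>The covariation of the first on the second coordinate of a vector with spectral
  measure \<open>\<sigma>\<close>.\<close>

definition covariation :: "real \<Rightarrow> (real^2) measure \<Rightarrow> real" where
  "covariation \<alpha> \<sigma> = (LINT s|\<sigma>. s $ 1 * signed_powr (s $ 2) (\<alpha> - 1))"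

end

theory Submission
  imports Defs
begin

text \<open>
  The proof compares two first-order expansions. Write \<open>h\<close> for the support function of \<open>K\<close> and
  let \<open>x\<close> be a support point of \<open>K\<close> in direction \<open>u\<close>, with \<open>c = h u > 0\<close>. For every
  direction \<open>v\<close> the function \<open>t \<mapsto> h (u + t v)\<close> lies above the affine function
  \<open>t \<mapsto> c + t (x \<bullet> v)\<close> and agrees with it at \<open>t = 0\<close>. Hence
  \<open>h (u + t v) powr \<alpha> - (c + t (x \<bullet> v)) powr \<alpha>\<close> has a local minimum at \<open>t = 0\<close>. Its first
  term is \<open>\<integral> \<bar>(u + t v) \<bullet> z\<bar> powr \<alpha> d\<sigma>\<close>, which, since \<open>\<alpha> > 1\<close>, may be differentiated under the
  integral sign, with derivative
  \<open>\<alpha> \<integral> (v \<bullet> z) signed_powr (u \<bullet> z) (\<alpha> - 1) d\<sigma>\<close> at \<open>0\<close>. The derivative of the difference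
  vanishes there, which gives
  \<open>\<integral> (v \<bullet> z) signed_powr (u \<bullet> z) (\<alpha> - 1) d\<sigma> = (x \<bullet> v) c powr (\<alpha> - 1)\<close>
  (\<open>spectral_integral_support_point\<close>). The covariation is the case of the two coordinate vectors.
  If \<open>c = 0\<close>, then \<open>u \<bullet> z = 0\<close> for almost every \<open>z\<close> and both sides are zero.

  The same formula shows that \<open>x \<bullet> v\<close> does not depend on the choice of \<open>x\<close> when \<open>c > 0\<close>, so the
  support point is unique (\<open>support_set_singleton\<close>). The condition \<open>c > 0\<close> can only fail if the
  component of \<open>\<xi>\<close> along \<open>u\<close> has constant characteristic function \<open>1\<close>, that is, if it is almost surely
  zero (\<open>support_fun_zero_imp_AE_zero\<close>).
\<close>

section \<open>Differentiating an integrated absolute power\<close>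

lemma abs_powr_has_derivative:
  fixes x p :: real
  assumes "1 < p"
  shows "((\<lambda>x. \<bar>x\<bar> powr p) has_real_derivative p * signed_powr x (p - 1)) (at x)"
proof (cases "x = 0")
  case True
  have "((\<lambda>h::real. \<bar>h\<bar> powr (p - 1)) \<longlongrightarrow> 0) (at 0)"
    by (rule tendsto_zero_powrI[where b = "p - 1"])
       (use assms in \<open>auto intro!: tendsto_eq_intros\<close>)
  then have "((\<lambda>h::real. \<bar>h\<bar> powr p / h) \<longlongrightarrow> 0) (at 0)"
  proof (rule Lim_null_comparison[rotated])
    have "norm (\<bar>h\<bar> powr p / h) \<le> \<bar>h\<bar> powr (p - 1)" if "h \<noteq> 0" for h :: real
      using that by (simp add: powr_diff abs_mult)
    then show "\<forall>\<^sub>F h::real in at 0. norm (\<bar>h\<bar> powr p / h) \<le> \<bar>h\<bar> powr (p - 1)"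
      by (auto simp: eventually_at_filter)
  qed
  then show ?thesis
    using True by (simp add: DERIV_def signed_powr_def)
next
  case False
  have "((\<lambda>x. \<bar>x\<bar>) has_real_derivative sgn x) (at x)"
  proof (rule has_field_derivative_transform_within_open)
    show "((\<lambda>y. sgn x * y) has_real_derivative sgn x) (at x)"
      by (auto intro!: derivative_eq_intros)
    show "sgn x * y = \<bar>y\<bar>" if "y \<in> ball x \<bar>x\<bar>" for y
      using that by (auto simp: dist_real_def sgn_if split: if_splits)
  qed (use False in auto)
  from DERIV_fun_powr[OF this, of p] False
  have "((\<lambda>x. \<bar>x\<bar> powr p) has_real_derivative p * \<bar>x\<bar> powr (p - 1) * sgn x) (at x)"
    by simp
  then show ?thesis
    by (simp add: signed_powr_def mult.assoc)
qed

text \<open>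
  The Lipschitz constant is the largest slope on \<open>[-R, R]\<close>. It supplies the integrable bound on
  difference quotients that dominated convergence requires below.
\<close>

lemma abs_powr_Lipschitz:
  fixes x y p R :: real
  assumes "1 < p" "\<bar>x\<bar> \<le> R" "\<bar>y\<bar> \<le> R"
  shows "\<bar>\<bar>x\<bar> powr p - \<bar>y\<bar> powr p\<bar> \<le> p * R powr (p - 1) * \<bar>x - y\<bar>"
proof -
  have "norm (\<bar>x\<bar> powr p - \<bar>y\<bar> powr p) \<le> (p * R powr (p - 1)) * norm (x - y)"
  proof (rule field_differentiable_bound)
    show "convex {-R..R}" by simp
    show "((\<lambda>x. \<bar>x\<bar> powr p) has_field_derivative p * signed_powr z (p - 1)) (at z within {-R..R})" for z
      using abs_powr_has_derivative[OF assms(1)] by (rule has_field_derivative_at_within)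
    show "norm (p * signed_powr z (p - 1)) \<le> p * R powr (p - 1)" if "z \<in> {-R..R}" for z
    proof -
      have "\<bar>z\<bar> powr (p - 1) \<le> R powr (p - 1)"
        using that assms by (intro powr_mono2) auto
      then show ?thesis
        using assms by (auto simp: signed_powr_def abs_mult abs_sgn_eq)
    qed
  qed (use assms in auto)
  then show ?thesis by simp
qed

lemma signed_powr_measurable [measurable (raw)]:
  assumes [measurable]: "f \<in> borel_measurable N"
  shows "(\<lambda>z. signed_powr (f z) p) \<in> borel_measurable N"
  unfolding signed_powr_def by measurable

text \<open>
  Differentiation under the integral sign by dominated convergence: for \<open>\<bar>t\<bar> \<le> 1\<close> all values
  \<open>g z + t * f z\<close> stay in \<open>[-(A + B), A + B]\<close>, so the difference quotients in \<open>t\<close> are bounded by a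
  constant, which is integrable because the measure is finite.
\<close>

lemma integral_abs_powr_has_derivative:
  fixes f g :: "'b \<Rightarrow> real"
  assumes "finite_measure N" and p: "1 < p"
    and [measurable]: "f \<in> borel_measurable N" "g \<in> borel_measurable N"
    and f: "\<And>z. z \<in> space N \<Longrightarrow> \<bar>f z\<bar> \<le> A" and g: "\<And>z. z \<in> space N \<Longrightarrow> \<bar>g z\<bar> \<le> B"
  shows "((\<lambda>t. LINT z|N. \<bar>g z + t * f z\<bar> powr p) has_real_derivative
           p * (LINT z|N. f z * signed_powr (g z) (p - 1))) (at 0)"
proof -
  interpret finite_measure N by fact
  let ?\<phi> = "\<lambda>t z. \<bar>g z + t * f z\<bar> powr p"
  define C where "C = p * (A + B) powr (p - 1) * A"
  have arg: "\<bar>g z + t * f z\<bar> \<le> A + B" if "\<bar>t\<bar> \<le> 1" "z \<in> space N" for t z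
  proof -
    have "\<bar>t * f z\<bar> \<le> 1 * A"
      unfolding abs_mult using that f by (intro mult_mono) auto
    then show ?thesis using g[OF that(2)] by linarith
  qed
  have int: "integrable N (?\<phi> t)" if "\<bar>t\<bar> \<le> 1" for t
    by (rule integrable_const_bound[where B = "(A + B) powr p"])
       (use arg[OF that] p in \<open>auto intro!: AE_I2 powr_mono2\<close>)
  have "(\<lambda>n. ((LINT z|N. ?\<phi> (X n) z) - (LINT z|N. ?\<phi> 0 z)) / X n)
          \<longlonglongrightarrow> p * (LINT z|N. f z * signed_powr (g z) (p - 1))"
    if X: "\<forall>n. X n \<in> UNIV - {0}" "X \<longlonglongrightarrow> 0" for X :: "nat \<Rightarrow> real"
  proof -
    \<comment> \<open>The bound on difference quotients holds for \<open>\<bar>t\<bar> \<le> 1\<close> only, so an initial segment is dropped.\<close>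
    have "\<forall>\<^sub>F n in sequentially. \<bar>X n\<bar> < 1"
      using X(2) by (intro order_tendstoD(2)[where y = 0]) (auto intro: tendsto_eq_intros)
    then obtain m where m: "\<And>n. \<bar>X (n + m)\<bar> \<le> 1"
      unfolding eventually_sequentially by (metis le_add2 less_imp_le)
    have nz: "X n \<noteq> 0" for n using X(1) by simp
    have "(\<lambda>n. LINT z|N. (?\<phi> (X (n + m)) z - ?\<phi> 0 z) / X (n + m))
            \<longlonglongrightarrow> (LINT z|N. p * (f z * signed_powr (g z) (p - 1)))"
    proof (rule integral_dominated_convergence[where w = "\<lambda>_. C"])
      show "AE z in N. (\<lambda>n. (?\<phi> (X (n + m)) z - ?\<phi> 0 z) / X (n + m))
               \<longlonglongrightarrow> p * (f z * signed_powr (g z) (p - 1))"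
      proof (rule AE_I2)
        fix z
        have "((\<lambda>t. ?\<phi> t z) has_real_derivative p * signed_powr (g z + 0 * f z) (p - 1) * f z) (at 0)"
          by (rule DERIV_chain2[OF abs_powr_has_derivative[OF p]])
             (auto intro!: derivative_eq_intros)
        then have "((\<lambda>t. (?\<phi> t z - ?\<phi> 0 z) / t) \<longlongrightarrow> p * (f z * signed_powr (g z) (p - 1))) (at 0)"
          by (simp add: DERIV_def ac_simps)
        moreover have "filterlim (\<lambda>n. X (n + m)) (at 0) sequentially"
          using X nz by (auto simp: filterlim_at intro: LIMSEQ_ignore_initial_segment)
        ultimately show "(\<lambda>n. (?\<phi> (X (n + m)) z - ?\<phi> 0 z) / X (n + m))
               \<longlonglongrightarrow> p * (f z * signed_powr (g z) (p - 1))"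
          by (rule filterlim_compose)
      qed
      show "AE z in N. norm ((?\<phi> (X (n + m)) z - ?\<phi> 0 z) / X (n + m)) \<le> C" for n
      proof (rule AE_I2)
        fix z assume z: "z \<in> space N"
        have "\<bar>?\<phi> (X (n + m)) z - ?\<phi> 0 z\<bar> \<le> p * (A + B) powr (p - 1) * \<bar>X (n + m) * f z\<bar>"
          using abs_powr_Lipschitz[OF p arg[OF m z] arg[of 0, OF _ z], of n] by simp
        also have "\<dots> \<le> p * (A + B) powr (p - 1) * (\<bar>X (n + m)\<bar> * A)"
          unfolding abs_mult using p f[OF z] by (intro mult_left_mono) auto
        finally show "norm ((?\<phi> (X (n + m)) z - ?\<phi> 0 z) / X (n + m)) \<le> C"
          using nz[of "n + m"] by (simp add: C_def field_simps)
      qed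
    qed simp_all
    then have "(\<lambda>n. ((LINT z|N. ?\<phi> (X (n + m)) z) - (LINT z|N. ?\<phi> 0 z)) / X (n + m))
            \<longlonglongrightarrow> p * (LINT z|N. f z * signed_powr (g z) (p - 1))"
      using int[OF m] int[of 0] by simp
    then show ?thesis by (rule LIMSEQ_offset)
  qed
  then show ?thesis
    unfolding DERIV_def tendsto_at_iff_sequentially comp_def by simp
qed

section \<open>Spectral measures and support functions\<close>

lemma spectral_measure_inner:
  fixes \<xi> :: "'w \<Rightarrow> 'a::euclidean_space"
  assumes "spectral_measure M \<alpha> \<xi> \<sigma>"
  shows "finite_measure \<sigma>"
    and "(\<lambda>z. u \<bullet> z) \<in> borel_measurable \<sigma>"
    and "z \<in> space \<sigma> \<Longrightarrow> \<bar>u \<bullet> z\<bar> \<le> norm u"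
proof -
  show "finite_measure \<sigma>" using assms by (simp add: spectral_measure_def)
  have "(\<lambda>z. u \<bullet> z) \<in> borel_measurable (restrict_space borel (sphere 0 1))"
    by (intro measurable_restrict_space1) measurable
  also have "\<dots> = borel_measurable \<sigma>"
    using assms by (intro measurable_cong_sets) (auto simp: spectral_measure_def)
  finally show "(\<lambda>z. u \<bullet> z) \<in> borel_measurable \<sigma>" .
  show "\<bar>u \<bullet> z\<bar> \<le> norm u" if "z \<in> space \<sigma>"
    using that assms Cauchy_Schwarz_ineq2[of u z] by (auto simp: spectral_measure_def)
qed

text \<open>
  Both integrals are minus the logarithm of the same characteristic function value; the exponents
  are real, so no branch of the complex logarithm intervenes. This allows the spectral measure in
  the definition of the zonoid to be replaced by any other one of the same vector.
\<close>

lemma spectral_integral_unique: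
  assumes "spectral_measure M \<alpha> \<xi> \<sigma>" "spectral_measure M \<alpha> \<xi> \<tau>"
  shows "(LINT z|\<sigma>. \<bar>u \<bullet> z\<bar> powr \<alpha>) = (LINT z|\<tau>. \<bar>u \<bullet> z\<bar> powr \<alpha>)"
proof -
  have "exp (complex_of_real (- (LINT z|\<sigma>. \<bar>u \<bullet> z\<bar> powr \<alpha>)))
      = exp (complex_of_real (- (LINT z|\<tau>. \<bar>u \<bullet> z\<bar> powr \<alpha>)))"
    using assms unfolding spectral_measure_def by (metis of_real_minus)
  then show ?thesis
    unfolding exp_of_real of_real_eq_iff by simp
qed

lemma zonoid_support_fun:
  assumes "associated_zonoid M \<alpha> \<xi> K" "spectral_measure M \<alpha> \<xi> \<sigma>"
  shows "support_fun K u powr \<alpha> = (LINT z|\<sigma>. \<bar>u \<bullet> z\<bar> powr \<alpha>)"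
  using assms spectral_integral_unique unfolding associated_zonoid_def by metis

lemma inner_le_support_fun:
  assumes "compact K" "x \<in> K"
  shows "x \<bullet> u \<le> support_fun K u"
  unfolding support_fun_def
proof (rule cSUP_upper[OF assms(2)])
  have "compact ((\<lambda>x. x \<bullet> u) ` K)"
    by (intro compact_continuous_image continuous_intros assms)
  then show "bdd_above ((\<lambda>x. x \<bullet> u) ` K)"
    by (intro bounded_imp_bdd_above compact_imp_bounded)
qed

lemma support_set_nonempty:
  assumes "compact K" "K \<noteq> {}"
  shows "support_set K u \<noteq> {}"
proof -
  obtain x where x: "x \<in> K" "\<And>y. y \<in> K \<Longrightarrow> y \<bullet> u \<le> x \<bullet> u"
    using continuous_attains_sup[OF assms, of "\<lambda>x. x \<bullet> u"]
      continuous_on_inner[OF continuous_on_id continuous_on_const] by blast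
  have "support_fun K u \<le> x \<bullet> u"
    unfolding support_fun_def using assms x by (intro cSUP_least) auto
  with inner_le_support_fun[OF assms(1) x(1), of u] x(1) show ?thesis
    unfolding support_set_def by force
qed

lemma support_fun_nonneg:
  fixes K :: "'a::euclidean_space set"
  assumes "compact K" "K \<noteq> {}" "uminus ` K = K"
  shows "0 \<le> support_fun K u"
proof -
  obtain x where "x \<in> K" using assms by auto
  moreover from this have "- x \<in> K" using assms(3) by blast
  ultimately show ?thesis
    using inner_le_support_fun[OF assms(1), of x u] inner_le_support_fun[OF assms(1), of "- x" u]
    by simp
qed

section \<open>Support points as gradients\<close>

text \<open>
  Up to the factor \<open>\<alpha>\<close>, both sides are the derivative of \<open>h\<^sup>\<alpha>\<close> at \<open>u\<close> in direction \<open>v\<close>, where \<open>h\<close> is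
  the support function: the left one by the integral representation, the right one because a
  support point is a subgradient of \<open>h\<close>.
\<close>

lemma spectral_integral_support_point:
  fixes \<xi> :: "'w \<Rightarrow> 'a::euclidean_space"
  assumes "1 < \<alpha>" and \<sigma>: "spectral_measure M \<alpha> \<xi> \<sigma>" and K: "associated_zonoid M \<alpha> \<xi> K"
    and x: "x \<in> support_set K u"
  shows "(LINT z|\<sigma>. (v \<bullet> z) * signed_powr (u \<bullet> z) (\<alpha> - 1))
           = (x \<bullet> v) * support_fun K u powr (\<alpha> - 1)"
proof (cases "support_fun K u = 0")
  case True
  note [measurable] = spectral_measure_inner(2)[OF \<sigma>]
  interpret finite_measure \<sigma> by (rule spectral_measure_inner(1)[OF \<sigma>])
  have "integrable \<sigma> (\<lambda>z. \<bar>u \<bullet> z\<bar> powr \<alpha>)"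
    by (rule integrable_const_bound[where B = "norm u powr \<alpha>"])
       (use assms spectral_measure_inner(3)[OF \<sigma>] in \<open>auto intro!: AE_I2 powr_mono2\<close>)
  moreover have "(LINT z|\<sigma>. \<bar>u \<bullet> z\<bar> powr \<alpha>) = 0"
    using zonoid_support_fun[OF K \<sigma>, of u] True by simp
  ultimately have "AE z in \<sigma>. u \<bullet> z = 0"
    by (subst (asm) integral_nonneg_eq_0_iff_AE) auto
  then have "(LINT z|\<sigma>. (v \<bullet> z) * signed_powr (u \<bullet> z) (\<alpha> - 1)) = (LINT z|\<sigma>. 0)"
    by (intro integral_cong_AE) (auto simp: signed_powr_def)
  then show ?thesis using True by simp
next
  case False
  have K': "compact K" "K \<noteq> {}" "uminus ` K = K"
    using K by (auto simp: associated_zonoid_def)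
  define c where "c = support_fun K u"
  have c: "0 < c" using False support_fun_nonneg[OF K', of u] by (simp add: c_def)
  have xK: "x \<in> K" "x \<bullet> u = c" using x by (auto simp: support_set_def c_def)
  \<comment> \<open>\<open>?G\<close> is a minorant of \<open>?F\<close> as long as \<open>c + t * (x \<bullet> v)\<close> is positive, with equality at \<open>0\<close>.
     The absolute value in \<open>?G\<close> makes it differentiable on the whole line.\<close>
  let ?F = "\<lambda>t. LINT z|\<sigma>. \<bar>u \<bullet> z + t * (v \<bullet> z)\<bar> powr \<alpha>"
  let ?G = "\<lambda>t. \<bar>c + t * (x \<bullet> v)\<bar> powr \<alpha>"
  define D where "D = (LINT z|\<sigma>. (v \<bullet> z) * signed_powr (u \<bullet> z) (\<alpha> - 1))"
  have F: "?F t = support_fun K (u + t *\<^sub>R v) powr \<alpha>" for t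
    using zonoid_support_fun[OF K \<sigma>, of "u + t *\<^sub>R v"] by (simp add: inner_add_left)
  have dF: "(?F has_real_derivative \<alpha> * D) (at 0)"
    unfolding D_def using assms(1) spectral_measure_inner[OF \<sigma>]
    by (intro integral_abs_powr_has_derivative[where A = "norm v" and B = "norm u"]) auto
  have dG: "(?G has_real_derivative \<alpha> * signed_powr (c + 0 * (x \<bullet> v)) (\<alpha> - 1) * (x \<bullet> v)) (at 0)"
    by (rule DERIV_chain2[OF abs_powr_has_derivative[OF assms(1)]])
       (auto intro!: derivative_eq_intros)
  have "isCont (\<lambda>t. c + t * (x \<bullet> v)) 0" by (intro continuous_intros)
  then have "\<forall>\<^sub>F t in at 0. 0 < c + t * (x \<bullet> v)"
    unfolding isCont_def using c by (intro order_tendstoD(1)) auto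
  then obtain d where d: "0 < d" "\<And>t. \<bar>t\<bar> < d \<Longrightarrow> 0 < c + t * (x \<bullet> v)"
    unfolding eventually_at using c by (auto simp: dist_real_def) (metis add.right_neutral mult_zero_left)
  have "\<alpha> * D - \<alpha> * signed_powr (c + 0 * (x \<bullet> v)) (\<alpha> - 1) * (x \<bullet> v) = 0"
  proof (rule DERIV_local_min[OF DERIV_diff[OF dF dG] d(1)], intro allI impI)
    fix t :: real assume "\<bar>0 - t\<bar> < d"
    then have pos: "0 < c + t * (x \<bullet> v)" using d(2) by simp
    have "c + t * (x \<bullet> v) \<le> support_fun K (u + t *\<^sub>R v)"
      using inner_le_support_fun[OF K'(1) xK(1), of "u + t *\<^sub>R v"] xK(2)
      by (simp add: inner_add_right)
    then have "?G t \<le> ?F t"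
      unfolding F using pos assms(1) by (intro powr_mono2) auto
    moreover have "?F 0 = ?G 0"
      unfolding F using c by (simp add: c_def)
    ultimately show "?F 0 - ?G 0 \<le> ?F t - ?G t" by simp
  qed
  then have "D = (x \<bullet> v) * c powr (\<alpha> - 1)"
    using assms(1) c by (simp add: signed_powr_def algebra_simps)
  then show ?thesis by (simp add: D_def c_def)
qed

text \<open>
  The formula above determines \<open>x \<bullet> v\<close> for every \<open>v\<close>, provided that the factor
  \<open>support_fun K u powr (\<alpha> - 1)\<close> can be cancelled.
\<close>

lemma support_set_singleton:
  fixes \<xi> :: "'w \<Rightarrow> 'a::euclidean_space"
  assumes "1 < \<alpha>" and K: "associated_zonoid M \<alpha> \<xi> K"
    and "support_fun K u \<noteq> 0"
  shows "\<exists>x. support_set K u = {x}"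
proof -
  have K': "compact K" "K \<noteq> {}" "uminus ` K = K"
    using K by (auto simp: associated_zonoid_def)
  obtain \<sigma> where \<sigma>: "spectral_measure M \<alpha> \<xi> \<sigma>"
    using K by (auto simp: associated_zonoid_def)
  have "x = y" if "x \<in> support_set K u" "y \<in> support_set K u" for x y
  proof -
    have "x \<bullet> v = y \<bullet> v" for v
      using spectral_integral_support_point[OF assms(1) \<sigma> K that(1), of v]
        spectral_integral_support_point[OF assms(1) \<sigma> K that(2), of v] assms(3) by simp
    then show ?thesis by (metis vector_eq_rdot)
  qed
  then show ?thesis using support_set_nonempty[OF K'(1,2), of u] by blast
qed

text \<open>
  By homogeneity the exponent of the characteristic function vanishes on the whole line through \<open>u\<close>,
  so \<open>\<xi> \<bullet> u\<close> has the characteristic function of the constant \<open>0\<close> and hence, by Levy's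
  uniqueness theorem, its law.
\<close>

lemma support_fun_zero_imp_AE_zero:
  fixes \<xi> :: "'w \<Rightarrow> 'a::euclidean_space"
  assumes "prob_space M" and [measurable]: "\<xi> \<in> borel_measurable M"
    and K: "associated_zonoid M \<alpha> \<xi> K" and "support_fun K u = 0"
  shows "AE \<omega> in M. \<xi> \<omega> \<bullet> u = 0"
proof -
  interpret prob_space M by fact
  obtain \<sigma> where \<sigma>: "spectral_measure M \<alpha> \<xi> \<sigma>"
    using K by (auto simp: associated_zonoid_def)
  let ?X = "\<lambda>\<omega>. \<xi> \<omega> \<bullet> u"
  have "char (distr M borel ?X) t = char (return borel 0) t" for t
  proof -
    have "(LINT z|\<sigma>. \<bar>(t *\<^sub>R u) \<bullet> z\<bar> powr \<alpha>) = (LINT z|\<sigma>. \<bar>t\<bar> powr \<alpha> * \<bar>u \<bullet> z\<bar> powr \<alpha>)"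
      by (simp add: abs_mult powr_mult)
    also have "\<dots> = \<bar>t\<bar> powr \<alpha> * support_fun K u powr \<alpha>"
      by (simp add: zonoid_support_fun[OF K \<sigma>])
    also have "\<dots> = 0" using assms(4) by simp
    finally have "(CLINT \<omega>|M. iexp (\<xi> \<omega> \<bullet> (t *\<^sub>R u))) = 1"
      using \<sigma> unfolding spectral_measure_def by (metis exp_zero minus_zero of_real_0)
    then have "char (distr M borel ?X) t = 1"
      unfolding char_def by (subst integral_distr) (auto simp: ac_simps)
    moreover have "char (return borel 0) t = 1"
      unfolding char_def by (subst integral_return) auto
    ultimately show ?thesis by simp
  qed
  then have eq: "distr M borel ?X = return borel 0"
    by (intro Levy_uniqueness)
       (auto simp: real_distribution_def real_distribution_axioms_def
          intro!: prob_space_distr prob_space_return)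
  have "AE y in return borel (0::real). y = 0"
    by (simp add: AE_return)
  then have "AE y in distr M borel ?X. y = 0" by (simp only: eq)
  then show ?thesis by (subst (asm) AE_distr_iff) auto
qed

section \<open>Covariation and the support point\<close>

theorem theorem9p1:
  fixes M :: "'w measure" and \<xi> :: "'w \<Rightarrow> real^2" and \<alpha> :: real
    and \<sigma> :: "(real^2) measure" and K :: "(real^2) set"
  assumes "prob_space M" and "\<xi> \<in> borel_measurable M"
    and "1 < \<alpha>" and "\<alpha> \<le> 2"
    and "sym_stable M \<alpha> \<xi>"
    and "spectral_measure M \<alpha> \<xi> \<sigma>"
    and "associated_zonoid M \<alpha> \<xi> K"
  shows "support_set K (vector [0, 1]) \<noteq> {} \<and>
    (\<not> (AE \<omega> in M. \<xi> \<omega> $ 2 = 0) \<longrightarrow>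
       (\<exists>x1 x2. support_set K (vector [0, 1]) = {vector [x1, x2]})) \<and>
    (\<forall>x1 x2. vector [x1, x2] \<in> support_set K (vector [0, 1]) \<longrightarrow>
       covariation \<alpha> \<sigma> = x1 * x2 powr (\<alpha> - 1))"
proof (intro conjI impI allI)
  let ?e1 = "vector [1, 0] :: real^2" and ?e2 = "vector [0, 1] :: real^2"
  have e: "z \<bullet> ?e1 = z $ 1" "z \<bullet> ?e2 = z $ 2" "?e1 \<bullet> z = z $ 1" "?e2 \<bullet> z = z $ 2" for z
    by (simp_all add: inner_vec_def sum_2)
  show "support_set K ?e2 \<noteq> {}"
    using assms(7) by (intro support_set_nonempty) (auto simp: associated_zonoid_def)
  show "\<exists>x1 x2. support_set K ?e2 = {vector [x1, x2]}" if "\<not> (AE \<omega> in M. \<xi> \<omega> $ 2 = 0)"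
  proof -
    have "support_fun K ?e2 \<noteq> 0"
      using support_fun_zero_imp_AE_zero[OF assms(1,2,7), of ?e2] that by (auto simp: e)
    then obtain x where "support_set K ?e2 = {x}"
      using support_set_singleton[OF assms(3,7)] by blast
    moreover have "x = vector [x $ 1, x $ 2]"
      by (simp add: vec_eq_iff forall_2)
    ultimately show ?thesis by metis
  qed
  show "covariation \<alpha> \<sigma> = x1 * x2 powr (\<alpha> - 1)"
    if "vector [x1, x2] \<in> support_set K ?e2" for x1 x2
  proof -
    have "support_fun K ?e2 = x2"
      using that by (simp add: support_set_def e)
    then show ?thesis
      using spectral_integral_support_point[OF assms(3,6,7) that, of ?e1]
      by (simp add: covariation_def e)
  qed
qed

end
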